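(* Fix a player $i$ and the actions $A_{-i}$ of all other players, in the high-PDR regime (SINR of player $i$ above $0$ dB, i.e. $\gamma_i>1$, for all $P_i\in[P_{\min},P_{\max}]$). Then the maximizer $A^o=\arg\max_{A_i\in\overline{A}}F(A_i,A_{-i})$ of the potential function over the action space $\overline{A}=[P_{\min},P_{\max}]\times\overline{R}$ is unique, and $$F(A^o,A_{-i})=\max\big\{F\big((P^{*_1},R_1),A_{-i}\big),\dots,F\big((P^{*_5},R_5),A_{-i}\big)\big\},$$ where $P^{*_x}$ denotes the maximizer of $P\mapsto F\big((P,R_x),A_{-i}\big)$ over $[P_{\min},P_{\max}]$, i.e. the maximizer when the rate is $R=R_x$.
   Context: Setting: $N\ge2$ players (wireless networks). The action of player $i$ is a pair $A_i=(P_i,R_i)$ with transmit power $P_i\in[P_{\min},P_{\max}]$, $0<P_{\min}<P_{\max}$, and data rate $R_i\in\overline{R}=\{R_1,\dots,R_5\}=\{25.6,\,51.2,\,76.8,\,102.4,\,128.0\}$ (kbps), so $R_{\min}=R_1$ and $R_{\max}=R_5$; $A_{-i}$ denotes the actions of the other players. The signal-to-interference-and-noise ratio (SINR) of player $i$ is $$\gamma_i=\frac{h_{ii}P_i}{\sum_{j\neq i}h_{ij}P_j+\sigma^2},$$ with $h_{ij}>0$, $\sigma>0$. The coefficient pairs $(\alpha(R_k),\beta(R_k))$, $k=1,\dots,5$, are $(-100.02,-3.66)$, $(-214.95,-2.82)$, $(-663.69,-2.79)$, $(-1182.7,-2.73)$, $(-1433.5,-2.58)$. With constants $c,q>0$ and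 $g>1$, the potential function is $$F(A_i,A_{-i})=-c\,P_i^{g}-\frac{q}{R_i}+\frac{\alpha(R_i)\,\gamma_i^{\beta(R_i)}}{2}+Q(A_{-i}),$$ where $Q(A_{-i})=\sum_{j\ne i}\Big(-cP_j^{g}-\frac{q}{R_j}+\frac{\alpha(R_j)\gamma_j^{\beta(R_j)}}{2}\Big)$ collects the terms of the other players and is treated as a function of $A_{-i}$ only, i.e. as a constant with respect to $A_i$. The potential function arises from the utility $-cP_i^g+\ln(1+\mathrm{PDR}_i)-q/R_i$, $\mathrm{PDR}_i=\exp(\alpha(R_i)\gamma_i^{\beta(R_i)})$, by first-order Taylor expansion of the logarithmic term (and dropping the constant $\ln 2$) in the high packet-delivery-ratio (PDR) regime.
   Formalization: Uniqueness of the maximizer fails for some q>0, where two rates tie for the top value. Instead: the maximizer is unique exactly when one rate attains the maximum of the five values, and this holds for all but finitely many q>0; existence and the max formula hold for every q>0. *)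

theory Defs
  imports "HOL-Analysis.Analysis"
begin

text \<open>An action is a pair (transmit power, data rate in kbps); a profile assigns an action to
  every player of the finite index type \<^typ>\<open>'n\<close>.\<close>

type_synonym action = "real \<times> real"

definition rates :: "real set" where
  "rates = {25.6, 51.2, 76.8, 102.4, 128.0}"

text \<open>The value outside \<^const>\<open>rates\<close> is immaterial.\<close>

definition alpha :: "real \<Rightarrow> real" where
  "alpha R =
    (if R = 25.6 then - 100.02
     else if R = 51.2 then - 214.95
     else if R = 76.8 then - 663.69
     else if R = 102.4 then - 1182.7
     else if R = 128.0 then - 1433.5
     else 0)"

definition beta :: "real \<Rightarrow> real" where
  "beta R =
    (if R = 25.6 then - 3.66
     else if R = 51.2 then - 2.82
     else if R = 76.8 then - 2.79
     else if R = 102.4 then - 2.73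
     else if R = 128.0 then - 2.58
     else 0)"

definition action_space :: "real \<Rightarrow> real \<Rightarrow> action set" where
  "action_space Pmin Pmax = {Pmin..Pmax} \<times> rates"

definition sinr :: "('n::finite \<Rightarrow> 'n \<Rightarrow> real) \<Rightarrow> real \<Rightarrow> ('n \<Rightarrow> action) \<Rightarrow> 'n \<Rightarrow> real" where
  "sinr h \<sigma> A i = h i i * fst (A i) / ((\<Sum>j\<in>UNIV - {i}. h i j * fst (A j)) + \<sigma>\<^sup>2)"

definition player_term ::
  "('n::finite \<Rightarrow> 'n \<Rightarrow> real) \<Rightarrow> real \<Rightarrow> real \<Rightarrow> real \<Rightarrow> real \<Rightarrow> ('n \<Rightarrow> action) \<Rightarrow> 'n \<Rightarrow> real" where
  "player_term h \<sigma> c g q A i =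
     - c * fst (A i) powr g - q / snd (A i)
     + alpha (snd (A i)) * sinr h \<sigma> A i powr beta (snd (A i)) / 2"

definition others_term ::
  "('n::finite \<Rightarrow> 'n \<Rightarrow> real) \<Rightarrow> real \<Rightarrow> real \<Rightarrow> real \<Rightarrow> real \<Rightarrow> ('n \<Rightarrow> action) \<Rightarrow> 'n \<Rightarrow> real" where
  "others_term h \<sigma> c g q A i = (\<Sum>j\<in>UNIV - {i}. player_term h \<sigma> c g q A j)"

text \<open>\<open>potential h \<sigma> c g q A i a\<close> is \<open>F(a, A\<^sub>-\<^sub>i)\<close>. The terms of the other players are
  constant in the action \<open>a\<close> of player \<open>i\<close>: the interference that player \<open>i\<close>
  causes to the others is frozen at the power given by the entry \<open>A i\<close>, which plays no other
  role here.\<close>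

definition potential ::
  "('n::finite \<Rightarrow> 'n \<Rightarrow> real) \<Rightarrow> real \<Rightarrow> real \<Rightarrow> real \<Rightarrow> real \<Rightarrow> ('n \<Rightarrow> action) \<Rightarrow> 'n \<Rightarrow>
    action \<Rightarrow> real" where
  "potential h \<sigma> c g q A i a =
     player_term h \<sigma> c g q (A(i := a)) i + others_term h \<sigma> c g q A i"

definition best_power :: "real \<Rightarrow> real \<Rightarrow> (action \<Rightarrow> real) \<Rightarrow> real \<Rightarrow> real" where
  "best_power Pmin Pmax F R = arg_max (\<lambda>P. F (P, R)) (\<lambda>P. P \<in> {Pmin..Pmax})"

end

theory Submission
  imports Defs
begin

text \<open>For a fixed rate the potential is, up to a constant, \<open>-c P\<^sup>g + \<alpha> (k P)\<^sup>\<beta> / 2\<close> with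
  \<open>k > 0\<close>; since \<open>\<alpha>, \<beta> < 0\<close> and \<open>g > 1\<close>, its derivative is strictly decreasing, so there is
  exactly one optimal power, and it does not depend on \<open>q\<close>. The joint maximizers are therefore
  the pairs of an optimal rate with its optimal power. As functions of \<open>q\<close>, the optimal values
  at two distinct rates differ by an affine function with nonzero slope, so they tie for at
  most one \<open>q\<close>.\<close>

text \<open>Existence is compactness. For uniqueness, the mean value theorem on the two halves of
  the interval between two maximizers gives a point with \<open>f' \<le> 0\<close> to the left of a
  point with \<open>f' \<ge> 0\<close>, which a strictly decreasing \<open>f'\<close>
  forbids.\<close>

lemma ex1_is_arg_max_strict_antimono_deriv:
  fixes f f' :: "real \<Rightarrow> real"
  assumes "a \<le> b"
    and deriv: "\<And>x. x \<in> {a..b} \<Longrightarrow> (f has_real_derivative f' x) (at x)"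
    and anti: "\<And>x y. x \<in> {a..b} \<Longrightarrow> y \<in> {a..b} \<Longrightarrow> x < y \<Longrightarrow> f' y < f' x"
  shows "\<exists>!x. is_arg_max f (\<lambda>x. x \<in> {a..b}) x"
proof -
  have "continuous_on {a..b} f"
    using deriv by (blast intro: continuous_at_imp_continuous_on DERIV_isCont)
  with \<open>a \<le> b\<close> obtain m where m: "m \<in> {a..b}" "\<And>y. y \<in> {a..b} \<Longrightarrow> f y \<le> f m"
    using continuous_attains_sup[of "{a..b}" f] by auto
  have no_two: False
    if "x < y" and mx: "is_arg_max f (\<lambda>x. x \<in> {a..b}) x"
      and my: "is_arg_max f (\<lambda>x. x \<in> {a..b}) y" for x y
  proof -
    \<comment> \<open>Comparing only \<open>f x\<close> with \<open>f y\<close> would give a single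
      zero of \<open>f'\<close>; an intermediate point is needed to get two slopes of opposite
      sign.\<close>
    define u where "u = (x + y) / 2"
    have xu: "x < u" "u < y" using \<open>x < y\<close> by (auto simp: u_def)
    have xy: "a \<le> x" "y \<le> b" using mx my by (auto simp: is_arg_max_def)
    have le: "f u \<le> f x" "f u \<le> f y"
      using mx my xu xy by (auto simp: is_arg_max_linorder)
    obtain z where z: "x < z" "z < u" "f u - f x = (u - x) * f' z"
      using MVT2[of x u f f'] deriv xu xy by auto
    obtain w where w: "u < w" "w < y" "f y - f u = (y - u) * f' w"
      using MVT2[of u y f f'] deriv xu xy by auto
    have "f' z \<le> 0" using z le xu by (smt (verit) mult_pos_pos)
    moreover have "0 \<le> f' w" using w le xu by (smt (verit) mult_pos_neg)
    moreover have "f' w < f' z" using anti[of z w] z w xu xy by auto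
    ultimately show False by simp
  qed
  show ?thesis
  proof (rule ex1I)
    show "is_arg_max f (\<lambda>x. x \<in> {a..b}) m" using m by (auto simp: is_arg_max_linorder)
    show "x = m" if "is_arg_max f (\<lambda>x. x \<in> {a..b}) x" for x
      using no_two[of x m] no_two[of m x] that \<open>is_arg_max f (\<lambda>x. x \<in> {a..b}) m\<close>
      by (metis linorder_neqE_linordered_idom)
  qed
qed

text \<open>As an equality of predicates, this also forces the choice operator behind
  \<open>arg_max\<close> to pick the same point.\<close>

lemma is_arg_max_add_const:
  fixes f :: "'a \<Rightarrow> real"
  shows "is_arg_max (\<lambda>x. f x + d) P = is_arg_max f P"
  by (auto simp: is_arg_max_linorder fun_eq_iff)

lemma arg_max_add_const:
  fixes f :: "'a \<Rightarrow> real"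
  shows "arg_max (\<lambda>x. f x + d) P = arg_max f P"
  by (simp add: arg_max_def is_arg_max_add_const)

text \<open>Maximization goes slice by slice: first over \<open>I\<close> for fixed
  \<open>R\<close>, then over the finitely many values \<open>V R\<close>. Uniqueness on each slice
  is what turns "some optimal \<open>P\<close>" into \<open>P = p R\<close>.\<close>

lemma is_arg_max_Times_iff:
  fixes F :: "'p \<times> 'r \<Rightarrow> 'v::linorder"
  assumes "finite X"
    and ex1: "\<And>R. R \<in> X \<Longrightarrow> \<exists>!P. is_arg_max (\<lambda>P. F (P, R)) (\<lambda>P. P \<in> I) P"
  defines "p \<equiv> \<lambda>R. arg_max (\<lambda>P. F (P, R)) (\<lambda>P. P \<in> I)"
  defines "V \<equiv> \<lambda>R. F (p R, R)"
  shows "is_arg_max F (\<lambda>a. a \<in> I \<times> X) (P, R) \<longleftrightarrow> R \<in> X \<and> P = p R \<and> V R = Max (V ` X)"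
    (is "?L \<longleftrightarrow> ?M")
proof -
  have p: "is_arg_max (\<lambda>P. F (P, R)) (\<lambda>P. P \<in> I) (p R)" if "R \<in> X" for R
    unfolding p_def arg_max_def by (rule someI_ex) (use ex1[OF that] in blast)
  have pI: "p R \<in> I" and pV: "P \<in> I \<Longrightarrow> F (P, R) \<le> V R" if "R \<in> X" for P R
    using p[OF that] by (auto simp: is_arg_max_linorder V_def)
  have V_le: "V R \<le> Max (V ` X)" if "R \<in> X" for R
    using that \<open>finite X\<close> by simp
  show ?thesis
  proof
    assume L: ?L
    then have R: "R \<in> X" and best: "\<And>P' R'. P' \<in> I \<Longrightarrow> R' \<in> X \<Longrightarrow> F (P', R') \<le> F (P, R)"
      by (auto simp: is_arg_max_linorder)
    have "is_arg_max (\<lambda>P. F (P, R)) (\<lambda>P. P \<in> I) P"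
      using L by (auto simp: is_arg_max_linorder)
    then have P: "P = p R" using ex1[OF R] p[OF R] by blast
    have "V R' \<le> V R" if "R' \<in> X" for R'
      using best[OF pI[OF that] that] by (simp add: V_def P)
    then have "V R = Max (V ` X)" using R \<open>finite X\<close> by (intro Max_eqI[symmetric]) auto
    with R P show ?M by blast
  next
    assume M: ?M
    then have "F (P', R') \<le> F (P, R)" if "P' \<in> I" "R' \<in> X" for P' R'
      using order_trans[OF pV V_le, of R' P'] that by (auto simp: V_def)
    then show ?L using M pI by (auto simp: is_arg_max_linorder)
  qed
qed

text \<open>If the best \<open>R\<close> is not unique, two distinct points of \<open>X\<close> tie.
  The term \<open>d q\<close> cancels, leaving a linear equation for \<open>q\<close> whose leading
  coefficient is nonzero by injectivity of \<open>s\<close>; there are finitely many pairs. The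
  function \<open>d\<close> need not be affine.\<close>

lemma finite_tie_parameters:
  fixes m s :: "'r \<Rightarrow> real" and d :: "real \<Rightarrow> real"
  assumes "finite X" "X \<noteq> {}" "inj_on s X"
    and V: "\<And>q R. R \<in> X \<Longrightarrow> V q R = m R + q * s R + d q"
  shows "finite {q. \<not> (\<exists>!R. R \<in> X \<and> V q R = Max (V q ` X))}"
proof (rule finite_subset)
  \<comment> \<open>The parameter at which \<open>R\<close> and \<open>R'\<close> tie. Diagonal
    pairs give \<open>0 / 0 = 0\<close>, which merely adds one harmless point to the finite
    superset.\<close>
  let ?t = "\<lambda>(R, R'). (m R' - m R) / (s R - s R')"
  show "finite (?t ` (X \<times> X))" using \<open>finite X\<close> by blast
  show "{q. \<not> (\<exists>!R. R \<in> X \<and> V q R = Max (V q ` X))} \<subseteq> ?t ` (X \<times> X)"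
  proof
    fix q assume q: "q \<in> {q. \<not> (\<exists>!R. R \<in> X \<and> V q R = Max (V q ` X))}"
    have "Max (V q ` X) \<in> V q ` X" using assms by (intro Max_in) auto
    then obtain R where R: "R \<in> X" "V q R = Max (V q ` X)" by force
    have "\<exists>R'. R' \<in> X \<and> R' \<noteq> R \<and> V q R' = V q R"
    proof (rule ccontr)
      assume "\<not> ?thesis"
      then have "\<exists>!R. R \<in> X \<and> V q R = Max (V q ` X)"
        using R by (intro ex1I[of _ R]) auto
      with q show False by simp
    qed
    then obtain R' where R': "R' \<in> X" "R' \<noteq> R" "V q R' = V q R" by blast
    have "s R \<noteq> s R'" using R R' \<open>inj_on s X\<close> by (auto dest: inj_onD)
    moreover have "q * (s R - s R') = m R' - m R"
      using R' V[of R q] V[of R' q] R by (simp add: algebra_simps)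
    ultimately have "q = ?t (R, R')" by (simp add: field_simps)
    then show "q \<in> ?t ` (X \<times> X)" using R R' by blast
  qed
qed

lemma finite_rates: "finite rates" and rates_nonempty: "rates \<noteq> {}"
  by (auto simp: rates_def)

lemma rates_pos: "R \<in> rates \<Longrightarrow> R > 0"
  by (auto simp: rates_def)

lemma alpha_neg: "R \<in> rates \<Longrightarrow> alpha R < 0"
  by (auto simp: rates_def alpha_def)

lemma beta_neg: "R \<in> rates \<Longrightarrow> beta R < 0"
  by (auto simp: rates_def beta_def)

text \<open>The SINR of player \<open>i\<close> is linear in its own power; this coefficient depends
  only on the powers of the others.\<close>

definition sinr_slope :: "('n::finite \<Rightarrow> 'n \<Rightarrow> real) \<Rightarrow> real \<Rightarrow> ('n \<Rightarrow> action) \<Rightarrow> 'n \<Rightarrow> real" where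
  "sinr_slope h \<sigma> A i = h i i / ((\<Sum>j\<in>UNIV - {i}. h i j * fst (A j)) + \<sigma>\<^sup>2)"

text \<open>The part of the potential that varies with the player's own power at rate
  \<open>R\<close>, with \<open>k\<close> standing for the SINR slope. It is free of
  \<open>q\<close>.\<close>

definition power_payoff :: "real \<Rightarrow> real \<Rightarrow> real \<Rightarrow> real \<Rightarrow> real \<Rightarrow> real" where
  "power_payoff k c g R P = - c * P powr g + alpha R * (k * P) powr beta R / 2"

lemma sinr_slope_pos:
  assumes "\<And>j. h i j > 0" "\<sigma> \<noteq> 0" "\<And>j. j \<noteq> i \<Longrightarrow> fst (A j) \<ge> 0"
  shows "sinr_slope h \<sigma> A i > 0"
proof -
  have "(\<Sum>j\<in>UNIV - {i}. h i j * fst (A j)) \<ge> 0"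
    using assms by (intro sum_nonneg mult_nonneg_nonneg) (auto intro: less_imp_le)
  then show ?thesis using assms
    by (auto simp: sinr_slope_def intro!: divide_pos_pos add_nonneg_pos)
qed

lemma sinr_update: "sinr h \<sigma> (A(i := (P, R))) i = sinr_slope h \<sigma> A i * P"
  by (simp add: sinr_def sinr_slope_def)

lemma potential_eq:
  "potential h \<sigma> c g q A i (P, R) =
     power_payoff (sinr_slope h \<sigma> A i) c g R P + (others_term h \<sigma> c g q A i - q / R)"
  by (simp add: potential_def player_term_def power_payoff_def sinr_update)

text \<open>The cost part of the derivative strictly decreases because \<open>g - 1 > 0\<close>. The
  other part is a positive multiple of a power with negative exponent \<open>beta R - 1\<close>,
  since \<open>alpha R\<close> and \<open>beta R\<close> are both negative. The bound
  \<open>0 < a\<close> keeps \<open>powr\<close> differentiable on the interval.\<close>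

lemma ex1_is_arg_max_power_payoff:
  assumes "k > 0" "c > 0" "g > 1" "0 < a" "a \<le> b" and R: "R \<in> rates"
  shows "\<exists>!P. is_arg_max (power_payoff k c g R) (\<lambda>P. P \<in> {a..b}) P"
proof (rule ex1_is_arg_max_strict_antimono_deriv[OF \<open>a \<le> b\<close>])
  let ?f' = "\<lambda>P. - c * (g * P powr (g - 1))
                 + alpha R * (beta R * (k * P) powr (beta R - 1) * k) / 2"
  fix x assume x: "x \<in> {a..b}"
  with assms have "x > 0" "k * x > 0" by auto
  then show "(power_payoff k c g R has_real_derivative ?f' x) (at x)"
    unfolding power_payoff_def
    by (auto intro!: derivative_eq_intros simp: powr_diff field_simps)
  fix y assume "y \<in> {a..b}" "x < y"
  have "x powr (g - 1) < y powr (g - 1)"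
    using \<open>x > 0\<close> \<open>x < y\<close> \<open>g > 1\<close> by (intro powr_less_mono2) auto
  then have "- c * (g * y powr (g - 1)) < - c * (g * x powr (g - 1))"
    using \<open>c > 0\<close> \<open>g > 1\<close> by simp
  moreover have "(k * y) powr (beta R - 1) \<le> (k * x) powr (beta R - 1)"
    using \<open>k * x > 0\<close> \<open>x < y\<close> \<open>k > 0\<close> beta_neg[OF R] by (intro powr_mono2') auto
  then have "(alpha R * beta R * k / 2) * (k * y) powr (beta R - 1)
      \<le> (alpha R * beta R * k / 2) * (k * x) powr (beta R - 1)"
    using alpha_neg[OF R] beta_neg[OF R] \<open>k > 0\<close>
    by (intro mult_left_mono) (auto simp: mult_nonpos_nonpos)
  ultimately show "?f' y < ?f' x" by (simp add: mult_ac)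
qed

theorem theorem7:
  fixes h :: "'n::finite \<Rightarrow> 'n \<Rightarrow> real"
    and \<sigma> c g Pmin Pmax :: real
    and A :: "'n \<Rightarrow> action"
    and i :: 'n
  assumes players: "CARD('n) \<ge> 2"
    and gains: "\<And>j k. h j k > 0"
    and noise: "\<sigma> > 0"
    and powers: "0 < Pmin" "Pmin < Pmax"
    and constants: "c > 0" "g > 1"
    and others: "\<And>j. j \<noteq> i \<Longrightarrow> A j \<in> action_space Pmin Pmax"
    and high_PDR: "\<And>P R. P \<in> {Pmin..Pmax} \<Longrightarrow> R \<in> rates \<Longrightarrow> sinr h \<sigma> (A(i := (P, R))) i > 1"
  shows
    "(\<forall>q>0.
        let S = action_space Pmin Pmax;
            F = potential h \<sigma> c g q A i;
            Ao = arg_max F (\<lambda>a. a \<in> S);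
            V = (\<lambda>R. F (best_power Pmin Pmax F R, R))
        in (\<forall>R\<in>rates. \<exists>!P. is_arg_max (\<lambda>P. F (P, R)) (\<lambda>P. P \<in> {Pmin..Pmax}) P)
           \<and> is_arg_max F (\<lambda>a. a \<in> S) Ao
           \<and> F Ao = Max (V ` rates)
           \<and> ((\<exists>!a. is_arg_max F (\<lambda>a. a \<in> S) a) \<longleftrightarrow> (\<exists>!R. R \<in> rates \<and> V R = Max (V ` rates))))
     \<and> finite {q. q > 0 \<and>
          \<not> (\<exists>!a. is_arg_max (potential h \<sigma> c g q A i) (\<lambda>a. a \<in> action_space Pmin Pmax) a)}"
proof -
  define k where "k = sinr_slope h \<sigma> A i"
  define p where "p = (\<lambda>R. arg_max (power_payoff k c g R) (\<lambda>P. P \<in> {Pmin..Pmax}))"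
  define V where "V = (\<lambda>q R. potential h \<sigma> c g q A i
    (best_power Pmin Pmax (potential h \<sigma> c g q A i) R, R))"
  have "fst (A j) \<ge> 0" if "j \<noteq> i" for j
    using others[OF that] powers by (auto simp: action_space_def)
  then have "k > 0" unfolding k_def using gains noise by (intro sinr_slope_pos) auto
  have ex1: "\<exists>!P. is_arg_max (\<lambda>P. potential h \<sigma> c g q A i (P, R)) (\<lambda>P. P \<in> {Pmin..Pmax}) P"
    if "R \<in> rates" for q R
    unfolding potential_eq is_arg_max_add_const k_def[symmetric]
    using ex1_is_arg_max_power_payoff \<open>k > 0\<close> constants powers that by simp
  have best: "best_power Pmin Pmax (potential h \<sigma> c g q A i) R = p R" for q R
    unfolding best_power_def potential_eq arg_max_add_const p_def k_def ..
  \<comment> \<open>The shape required by \<open>finite_tie_parameters\<close>: slope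
    \<open>- 1 / R\<close> in \<open>q\<close>, and the others' terms, which also vary with
    \<open>q\<close> but not with \<open>R\<close>, in the role of \<open>d q\<close>.\<close>
  have V_eq: "V q R = power_payoff k c g R (p R) + q * (- 1 / R) + others_term h \<sigma> c g q A i"
    for q R
    unfolding V_def best potential_eq k_def by simp
  have iff: "is_arg_max (potential h \<sigma> c g q A i) (\<lambda>a. a \<in> action_space Pmin Pmax) (P, R)
      \<longleftrightarrow> R \<in> rates \<and> P = p R \<and> V q R = Max (V q ` rates)" for q P R
    using is_arg_max_Times_iff[OF finite_rates,
      of "potential h \<sigma> c g q A i" "{Pmin..Pmax}" P R, OF ex1]
    unfolding best_power_def[symmetric] action_space_def[symmetric] best V_def by simp
  \<comment> \<open>By \<open>iff\<close> the maximizers are exactly the pairs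
    \<open>(p R, R)\<close> with \<open>R\<close> optimal, so they correspond one to one to the
    optimal rates.\<close>
  have ex1_iff: "(\<exists>!a. is_arg_max (potential h \<sigma> c g q A i)
        (\<lambda>a. a \<in> action_space Pmin Pmax) a)
      \<longleftrightarrow> (\<exists>!R. R \<in> rates \<and> V q R = Max (V q ` rates))" for q
    unfolding Ex1_def split_paired_Ex split_paired_All iff by auto
  have Ao: "is_arg_max (potential h \<sigma> c g q A i) (\<lambda>a. a \<in> action_space Pmin Pmax)
      (arg_max (potential h \<sigma> c g q A i) (\<lambda>a. a \<in> action_space Pmin Pmax))" for q
  proof -
    \<comment> \<open>Some maximizer must be exhibited before \<open>arg_max\<close> is known to
      return one; a best rate with its optimal power serves.\<close>
    have "Max (V q ` rates) \<in> V q ` rates"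
      using finite_rates rates_nonempty by (intro Max_in) auto
    then obtain R where "R \<in> rates" "V q R = Max (V q ` rates)" by force
    then have "\<exists>a. is_arg_max (potential h \<sigma> c g q A i) (\<lambda>a. a \<in> action_space Pmin Pmax) a"
      using iff by blast
    then show ?thesis unfolding arg_max_def by (rule someI_ex)
  qed
  have Ao_val: "potential h \<sigma> c g q A i
      (arg_max (potential h \<sigma> c g q A i) (\<lambda>a. a \<in> action_space Pmin Pmax))
      = Max (V q ` rates)" for q
    using Ao[of q]
    \<comment> \<open>The chosen action is split into power and rate so that \<open>iff\<close>
      applies and identifies its power as \<open>p R\<close> and its value as the maximum.\<close>
    by (cases "arg_max (potential h \<sigma> c g q A i) (\<lambda>a. a \<in> action_space Pmin Pmax)")
      (simp add: iff, simp add: V_def best)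
  \<comment> \<open>Distinct rates give distinct slopes in \<open>q\<close>, so no two value lines
    are parallel.\<close>
  have "inj_on (\<lambda>R::real. - 1 / R) rates"
    using rates_pos by (fastforce simp: inj_on_def)
  then have "finite {q. \<not> (\<exists>!R. R \<in> rates \<and> V q R = Max (V q ` rates))}"
    by (rule finite_tie_parameters[OF finite_rates rates_nonempty]) (rule V_eq)
  then have "finite {q. q > 0 \<and>
      \<not> (\<exists>!a. is_arg_max (potential h \<sigma> c g q A i) (\<lambda>a. a \<in> action_space Pmin Pmax) a)}"
    unfolding ex1_iff by (rule rev_finite_subset) blast
  then show ?thesis
    unfolding Let_def
    by (intro conjI allI impI ballI ex1 Ao Ao_val[unfolded V_def] ex1_iff[unfolded V_def])
qed

end
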